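(* Let $q\in\mathbb{R}$ and $p_1,p_2\in\mathbb{R}$ be such that for each $i=1,2$ either $p_i\le0$ or $0<p_i\le 3q$. Consider the double inequality \[ \left(1-\frac{p_1}{3q}+\frac{p_1}{3q}\cos^q x\right)^{1/p_1}<\frac{\sin x}{x}<\left(1-\frac{p_2}{3q}+\frac{p_2}{3q}\cos^q x\right)^{1/p_2}\qquad (x\in(0,\pi/2)). \tag{$*$} \] (i) If $q\ge1$, then $( * )$ holds for all $x\in(0,\pi/2)$ if and only if $p_1\ge p(q)$ and $p_2\le 3q-\frac85$. (ii) If $0<q\le\frac{34}{35}$, then $( * )$ holds for all $x\in(0,\pi/2)$ if and only if $p_1\ge 3q-\frac85$ and $p_2\le p(q)$. (iii) If $q\le0$, then the first inequality in $( * )$ holds for all $x\in(0,\pi/2)$ if and only if $p_1\ge 3q-\frac85$.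
   Context: The expressions in $( * )$ are interpreted by limits when $p_i=0$ or $q=0$: $\left(1-\frac{p}{3q}+\frac{p}{3q}t^q\right)^{1/p}$ means $\exp\frac{t^q-1}{3q}$ if $p=0\ne q$, $\left(1+\frac p3\ln t\right)^{1/p}$ if $q=0\ne p$, and $t^{1/3}$ if $p=q=0$. For $q>0$, $p(q)$ denotes the unique real $p$ with $\frac{q}{p}\left(1-\left(\frac2\pi\right)^p\right)=\frac13$ (for $p=0$ the left side means $q\ln\frac\pi2$); equivalently $p(q)$ is the inverse function of $q(p)=\frac{p}{3(1-(2/\pi)^p)}$ ($q(0)=\frac{1}{3\ln(\pi/2)}$). *)

theory Defs
  imports Complex_Main
begin

text \<open>The power mean expression in the double inequality, with the limiting
conventions of the paper: for t = cos x,
M p q t = (1 - p/(3q) + p/(3q) t^q)^(1/p), interpreted by limits when p = 0 or q = 0.\<close>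
definition Mpq :: "real \<Rightarrow> real \<Rightarrow> real \<Rightarrow> real" where
  "Mpq p q t =
     (if p = 0 \<and> q = 0 then t powr (1/3)
      else if p = 0 then exp ((t powr q - 1) / (3 * q))
      else if q = 0 then (1 + p / 3 * ln t) powr (1 / p)
      else (1 - p / (3 * q) + p / (3 * q) * t powr q) powr (1 / p))"

definition pcrit :: "real \<Rightarrow> real" where
  "pcrit q = (THE p. (if p = 0 then q * ln (pi / 2)
                       else q / p * (1 - (2 / pi) powr p)) = 1 / 3)"

definition lower_ineq :: "real \<Rightarrow> real \<Rightarrow> bool" where
  "lower_ineq p q \<longleftrightarrow> (\<forall>x\<in>{0<..<pi/2}. Mpq p q (cos x) < sin x / x)"

definition upper_ineq :: "real \<Rightarrow> real \<Rightarrow> bool" where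
  "upper_ineq p q \<longleftrightarrow> (\<forall>x\<in>{0<..<pi/2}. sin x / x < Mpq p q (cos x))"

end

theory Submission
  imports Defs "HOL-Real_Asymp.Real_Asymp"
begin

text \<open>Write $U_p(y) = (y^p - 1)/p$ (with $U_0 = \ln$), $s = \sin x$, $c = \cos x$, $w = s - x c$.
  Both inequalities concern the sign of $D = 3\,U_p(s/x) - U_q(c)$, which vanishes at $0$.
  The sign of $D'$ is that of $L = (q-1)\ln c + \ln (x^2 s/(3w)) - (p-1)\ln (s/x)$,
  which again vanishes at $0$, and $L' = G\,w/(x s)$ with
  $G = p - E - (q-1) B$, $B = x s^2/(c w)$, $E = x^2 s^2/w^2 - 3 s/w + 2$.
  Both $E$ and $B/35 - E$ are increasing, by Taylor estimates for trigonometric polynomials.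
  Hence $G$ decreases for $q \ge 1$ and increases for $q \le 34/35$. Its limit
  $p - (3q - 8/5)$ at $0$ decides the sign of $D$ near $0$, while $p = p(q)$ means exactly that
  $D$ also vanishes at $\pi/2$.\<close>

subsection \<open>Trigonometric polynomials\<close>

text \<open>The Maclaurin remainder bound is multiplied through by \<open>x ^ p\<close> and written
  in plain monomials of \<open>x\<close>. Every term \<open>x ^ p * sin (k * x)\<close> then comes
  with linear bounds over the same powers of \<open>x\<close>.\<close>

lemma sin_scaled_Taylor_bound:
  fixes x k :: real
  assumes "0 \<le> x" "0 \<le> k"
  shows "\<bar>x ^ p * sin (k * x) - (\<Sum>m<n. sin_coeff m * k ^ m * x ^ (m + p))\<bar>
    \<le> k ^ n / fact n * x ^ (n + p)"
proof -
  have "\<bar>sin (k * x) - (\<Sum>m<n. sin_coeff m * (k * x) ^ m)\<bar> \<le> (k * x) ^ n / fact n"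
    using Maclaurin_sin_bound[of "k * x" n] assms
    by (simp add: divide_inverse abs_mult mult.commute)
  then have "x ^ p * \<bar>sin (k * x) - (\<Sum>m<n. sin_coeff m * (k * x) ^ m)\<bar>
      \<le> x ^ p * ((k * x) ^ n / fact n)"
    using assms by (intro mult_left_mono) auto
  also have "x ^ p * \<bar>sin (k * x) - (\<Sum>m<n. sin_coeff m * (k * x) ^ m)\<bar>
      = \<bar>x ^ p * (sin (k * x) - (\<Sum>m<n. sin_coeff m * (k * x) ^ m))\<bar>"
    using assms by (simp add: abs_mult)
  finally show ?thesis
    by (simp add: right_diff_distrib sum_distrib_left power_mult_distrib power_add mult_ac)
qed

lemma cos_scaled_Taylor_bound:
  fixes x k :: real
  assumes "0 \<le> x" "0 \<le> k"
  shows "\<bar>x ^ p * cos (k * x) - (\<Sum>m<n. cos_coeff m * k ^ m * x ^ (m + p))\<bar>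
    \<le> k ^ n / fact n * x ^ (n + p)"
proof -
  obtain t where t: "cos (k * x) = (\<Sum>m<n. cos_coeff m * (k * x) ^ m)
      + cos (t + 1/2 * real n * pi) / fact n * (k * x) ^ n"
    using Maclaurin_cos_expansion[of "k * x" n] by blast
  have "\<bar>cos (k * x) - (\<Sum>m<n. cos_coeff m * (k * x) ^ m)\<bar>
      = \<bar>cos (t + 1/2 * real n * pi)\<bar> * ((k * x) ^ n / fact n)"
    using assms by (simp add: t abs_mult)
  also have "\<dots> \<le> 1 * ((k * x) ^ n / fact n)"
    using assms by (intro mult_right_mono) auto
  finally have "x ^ p * \<bar>cos (k * x) - (\<Sum>m<n. cos_coeff m * (k * x) ^ m)\<bar>
      \<le> x ^ p * ((k * x) ^ n / fact n)"
    using assms by (intro mult_left_mono) auto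
  also have "x ^ p * \<bar>cos (k * x) - (\<Sum>m<n. cos_coeff m * (k * x) ^ m)\<bar>
      = \<bar>x ^ p * (cos (k * x) - (\<Sum>m<n. cos_coeff m * (k * x) ^ m))\<bar>"
    using assms by (simp add: abs_mult)
  finally show ?thesis
    by (simp add: right_diff_distrib sum_distrib_left power_mult_distrib power_add mult_ac)
qed

text \<open>The \<open>lower\<close> facts bound function minus polynomial from above, hence the
  function from above; the \<open>upper\<close> facts bound the function from below.\<close>

lemmas sin_scaled_Taylor_lower = sin_scaled_Taylor_bound[THEN abs_le_D1]
  and sin_scaled_Taylor_upper = sin_scaled_Taylor_bound[THEN abs_le_D2]
  and cos_scaled_Taylor_lower = cos_scaled_Taylor_bound[THEN abs_le_D1]
  and cos_scaled_Taylor_upper = cos_scaled_Taylor_bound[THEN abs_le_D2]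

lemma pi_half_squared_le: "(pi / 2)\<^sup>2 \<le> 5 / 2"
proof -
  \<comment> \<open>The number 79/50 lies just above \<open>pi / 2\<close>, and its square 2.4964 is
    still below 5/2.\<close>
  have "cos (79/50 :: real) < 0"
    using cos_scaled_Taylor_lower[of "79/50" 1 0 8]
    by (simp add: cos_coeff_def lessThan_nat_numeral fact_numeral power_divide)
  then have "\<not> 79/50 \<le> pi / 2"
    using cos_ge_zero[of "79/50"] by auto
  then have "(pi / 2)\<^sup>2 \<le> (79/50)\<^sup>2"
    by (intro power_mono) auto
  then show ?thesis
    by (simp add: power2_eq_square)
qed

lemma square_less_five_halves:
  fixes x :: real
  assumes "0 < x" "x < pi / 2"
  shows "x\<^sup>2 < 5 / 2"
  using power_strict_mono[of x "pi / 2" 2] pi_half_squared_le assms by auto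

section \<open>Multiple-angle formulas in powers of the sine\<close>

lemma sin_treble: "sin (3 * x) = 3 * sin x - 4 * sin x ^ 3" for x :: real
proof -
  have "sin (3 * x) = sin (2 * x + x)" by simp
  also have "\<dots> = 2 * sin x * (cos x)\<^sup>2 + (1 - 2 * (sin x)\<^sup>2) * sin x"
    by (simp only: sin_add sin_double cos_double_sin) (simp add: power2_eq_square)
  also have "\<dots> = 3 * sin x - 4 * sin x ^ 3"
    unfolding cos_squared_eq by (simp add: algebra_simps power2_eq_square power3_eq_cube)
  finally show ?thesis .
qed

text \<open>One factor \<open>cos x\<close> is kept and all even powers of the cosine become powers
  of the sine. This is the normal form that \<open>cos_squared_eq\<close> produces in the
  linearisations below.\<close>

lemma cos_treble: "cos (3 * x) = cos x * (1 - 4 * (sin x)\<^sup>2)" for x :: real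
proof -
  have "cos (3 * x) = cos x * (4 * (cos x)\<^sup>2 - 3)"
    unfolding cos_treble_cos by (simp add: algebra_simps power2_eq_square power3_eq_cube)
  then show ?thesis by (simp add: cos_squared_eq)
qed

lemma sin_quintuple:
  "sin (5 * x) = 16 * sin x ^ 5 - 20 * sin x ^ 3 + 5 * sin x" for x :: real
proof -
  have "sin (5 * x) = sin (3 * x + 2 * x)" by simp
  also have "\<dots> = (3 * sin x - 4 * sin x ^ 3) * (1 - 2 * (sin x)\<^sup>2)
      + (cos x)\<^sup>2 * (1 - 4 * (sin x)\<^sup>2) * (2 * sin x)"
    by (simp only: sin_add sin_treble cos_treble sin_double cos_double_sin)
      (simp add: power2_eq_square)
  also have "\<dots> = 16 * sin x ^ 5 - 20 * sin x ^ 3 + 5 * sin x"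
    unfolding cos_squared_eq by (simp add: algebra_simps eval_nat_numeral)
  finally show ?thesis .
qed

lemma cos_quintuple:
  "cos (5 * x) = cos x * (16 * sin x ^ 4 - 12 * (sin x)\<^sup>2 + 1)" for x :: real
proof -
  have "cos (5 * x) = cos (3 * x + 2 * x)" by simp
  also have "\<dots> = cos x * ((1 - 4 * (sin x)\<^sup>2) * (1 - 2 * (sin x)\<^sup>2)
      - (3 * sin x - 4 * sin x ^ 3) * (2 * sin x))"
    by (simp only: cos_add sin_treble cos_treble sin_double cos_double_sin)
      (simp add: algebra_simps)
  also have "\<dots> = cos x * (16 * sin x ^ 4 - 12 * (sin x)\<^sup>2 + 1)"
    by (simp add: algebra_simps eval_nat_numeral)
  finally show ?thesis .
qed

text \<open>The difference factors as \<open>x ^ m * (a - b * x\<^sup>2)\<close>. It lets a negative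
  monomial be paid for by the preceding even power.\<close>

lemma consecutive_even_powers_pos:
  fixes x a b :: real
  assumes "0 < x" "x\<^sup>2 < 5 / 2" "0 \<le> b" "5 / 2 * b \<le> a"  "n = Suc (Suc m)" "0 < a"
  shows "0 < a * x ^ m - b * x ^ n"
proof -
  have "b * x\<^sup>2 < a"
  proof (cases "b = 0")
    case False
    then have "b * x\<^sup>2 < b * (5/2)" using assms by (intro mult_strict_left_mono) auto
    then show ?thesis using assms by linarith
  qed (use assms in auto)
  then have "0 < x ^ m * (a - b * x\<^sup>2)" using assms by simp
  then show ?thesis using assms by (simp add: algebra_simps power2_eq_square)
qed

text \<open>The numerator of the derivative of \<open>gap_E\<close>.\<close>
lemma numerator1_pos:
  fixes x :: real
  assumes "0 < x" "x < pi / 2"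
  shows "0 < 3 * (x - cos x * sin x) * (sin x - x * cos x)
            - 2 * x * sin x * (x\<^sup>2 - (sin x)\<^sup>2)"
proof -
  have x: "0 \<le> x" and x2: "x\<^sup>2 < 5 / 2" using assms square_less_five_halves by auto
  \<comment> \<open>Products of sines and cosines are linearised into terms
    \<open>x ^ j * sin (k * x)\<close> and \<open>x ^ j * cos (k * x)\<close>, to which the Taylor
    bounds apply one by one.\<close>
  have s1: "3 * (x - cos x * sin x) * (sin x - x * cos x)
            - 2 * x * sin x * (x\<^sup>2 - (sin x)\<^sup>2)
    = 21/4 * (x * sin x) + 1/4 * (x * sin (3*x)) - 2 * (x ^ 3 * sin x)
      - 3 * (x\<^sup>2 * cos x) - 3/4 * cos x + 3/4 * cos (3*x)"
  proof -
    have "3 * (x - cos x * sin x) * (sin x - x * cos x)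
            - 2 * x * sin x * (x\<^sup>2 - (sin x)\<^sup>2)
      = 3 * x * sin x - 3 * x\<^sup>2 * cos x - 3 * cos x * (sin x)\<^sup>2
        + 3 * x * sin x * (cos x)\<^sup>2 - 2 * x ^ 3 * sin x + 2 * x * sin x ^ 3"
      by (simp add: algebra_simps power2_eq_square power3_eq_cube)
    then show ?thesis
      unfolding cos_squared_eq sin_treble cos_treble
      by (simp add: algebra_simps power2_eq_square power3_eq_cube)
  qed
  \<comment> \<open>These rules evaluate the Taylor sums to explicit polynomials. Without
    \<open>power_Suc\<close> the powers of \<open>x\<close> stay whole, as atoms for linear
    arithmetic.\<close>
  note [simp] = lessThan_nat_numeral fact_numeral sin_coeff_def cos_coeff_def
      numeral_2_eq_2 [symmetric]
    and power_Suc [simp del]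
  \<comment> \<open>The orders are chosen so that every remainder is a multiple of
    \<open>x ^ 18\<close>.\<close>
  note t1 = sin_scaled_Taylor_lower[OF x, of 1 1 17, simplified]
    sin_scaled_Taylor_upper[OF x, of 1 1 17, simplified]
  note t2 = sin_scaled_Taylor_lower[OF x, of 3 1 17, simplified]
    sin_scaled_Taylor_upper[OF x, of 3 1 17, simplified]
  note t3 = sin_scaled_Taylor_lower[OF x, of 1 3 15, simplified]
    sin_scaled_Taylor_upper[OF x, of 1 3 15, simplified]
  note t4 = cos_scaled_Taylor_lower[OF x, of 1 2 16, simplified]
    cos_scaled_Taylor_upper[OF x, of 1 2 16, simplified]
  note t5 = cos_scaled_Taylor_lower[OF x, of 1 0 18, simplified]
    cos_scaled_Taylor_upper[OF x, of 1 0 18, simplified]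
  note t6 = cos_scaled_Taylor_lower[OF x, of 3 0 18, simplified]
    cos_scaled_Taylor_upper[OF x, of 3 0 18, simplified]
  have p1: "0 < 8/4725 * x ^ 10 - 4/14175 * x ^ 12"
    by (rule consecutive_even_powers_pos) (use assms x2 in auto)
  \<comment> \<open>The coefficient 1/43659 of \<open>x ^ 14\<close> is split in two: this share
    pays for the \<open>x ^ 16\<close> term, the share in \<open>p3\<close> and then
    \<open>p4\<close> for the Taylor remainder.\<close>
  have p2: "0 < 1/50000 * x ^ 14 - 73/60810750 * x ^ 16"
    by (rule consecutive_even_powers_pos) (use assms x2 in auto)
  have p3: "0 < 6341/2182950000 * x ^ 14 - 1/1000000 * x ^ 16"
    by (rule consecutive_even_powers_pos) (use assms x2 in auto)
  have p4: "0 < 13/5 * x ^ 16 - 1 * x ^ 18"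
    by (rule consecutive_even_powers_pos) (use assms x2 in auto)
  have "0 < x ^ 16" using assms by simp
  \<comment> \<open>The coefficient of \<open>x ^ 18\<close> rounds up the sum of all remainders,
    which the two terms in \<open>3*x\<close> dominate.\<close>
  moreover have "8/4725 * x ^ 10 - 4/14175 * x ^ 12 + 1/43659 * x ^ 14
      - 73/60810750 * x ^ 16 - 137/1000000000 * x ^ 18
    \<le> 21/4 * (x * sin x) + 1/4 * (x * sin (3*x)) - 2 * (x ^ 3 * sin x)
      - 3 * (x\<^sup>2 * cos x) - 3/4 * cos x + 3/4 * cos (3*x)"
  proof -
    have "0 \<le> x ^ 18" using x by simp
    with t1 t2 t3 t4 t5 t6 show ?thesis by linarith
  qed
  ultimately show ?thesis unfolding s1 using p1 p2 p3 p4
    by linarith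
qed

text \<open>The numerator of the derivative of \<open>gap_B / 35 - gap_E\<close>; the constant 35 is the largest
  one for which this holds, since both sides have the same leading term at 0.\<close>
lemma numerator2_pos:
  fixes x :: real
  assumes "0 < x" "x < pi / 2"
  defines "w \<equiv> sin x - x * cos x"
  shows "35 * (cos x)\<^sup>2 * (3 * (x - cos x * sin x) * w
            - 2 * x * sin x * (x\<^sup>2 - (sin x)\<^sup>2))
      < w * sin x * ((sin x)\<^sup>2 * cos x + x * sin x - 2 * x\<^sup>2 * cos x)"
proof -
  have x: "0 \<le> x" and x2: "x\<^sup>2 < 5 / 2" using assms square_less_five_halves by auto
  have s2: "w * sin x * ((sin x)\<^sup>2 * cos x + x * sin x - 2 * x\<^sup>2 * cos x)
      - 35 * (cos x)\<^sup>2 * (3 * (x - cos x * sin x) * w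
            - 2 * x * sin x * (x\<^sup>2 - (sin x)\<^sup>2))
    = 53/4 * cos x - 27/4 * cos (3*x) - 13/2 * cos (5*x)
      - 95/2 * (x * sin x) - 405/8 * (x * sin (3*x)) - 17/8 * (x * sin (5*x))
      + 78 * (x\<^sup>2 * cos x) + 27 * (x\<^sup>2 * cos (3*x))
      + 18 * (x ^ 3 * sin x) + 18 * (x ^ 3 * sin (3*x))"
  proof -
    have "w * sin x * ((sin x)\<^sup>2 * cos x + x * sin x - 2 * x\<^sup>2 * cos x)
      - 35 * (cos x)\<^sup>2 * (3 * (x - cos x * sin x) * w
            - 2 * x * sin x * (x\<^sup>2 - (sin x)\<^sup>2))
      = sin x ^ 4 * cos x + x * sin x ^ 3 - 2 * x\<^sup>2 * (sin x)\<^sup>2 * cos x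
        - x * (cos x)\<^sup>2 * sin x ^ 3 - x\<^sup>2 * cos x * (sin x)\<^sup>2
        + 2 * x ^ 3 * sin x * (cos x)\<^sup>2
        - 35 * (cos x)\<^sup>2 * (3 * x * sin x - 3 * x\<^sup>2 * cos x
          - 3 * cos x * (sin x)\<^sup>2 + 3 * x * sin x * (cos x)\<^sup>2
          - 2 * x ^ 3 * sin x + 2 * x * sin x ^ 3)"
      unfolding w_def by (simp add: algebra_simps eval_nat_numeral)
    then show ?thesis
      unfolding cos_squared_eq sin_treble cos_treble sin_quintuple cos_quintuple
      by (simp add: algebra_simps eval_nat_numeral)
  qed
  note [simp] = lessThan_nat_numeral fact_numeral sin_coeff_def cos_coeff_def
      numeral_2_eq_2 [symmetric]
    and power_Suc [simp del]
  note t1 = cos_scaled_Taylor_lower[OF x, of 1 0 24, simplified]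
    cos_scaled_Taylor_upper[OF x, of 1 0 24, simplified]
  note t2 = cos_scaled_Taylor_lower[OF x, of 3 0 24, simplified]
    cos_scaled_Taylor_upper[OF x, of 3 0 24, simplified]
  note t3 = cos_scaled_Taylor_lower[OF x, of 5 0 24, simplified]
    cos_scaled_Taylor_upper[OF x, of 5 0 24, simplified]
  note t4 = sin_scaled_Taylor_lower[OF x, of 1 1 23, simplified]
    sin_scaled_Taylor_upper[OF x, of 1 1 23, simplified]
  note t5 = sin_scaled_Taylor_lower[OF x, of 3 1 23, simplified]
    sin_scaled_Taylor_upper[OF x, of 3 1 23, simplified]
  note t6 = sin_scaled_Taylor_lower[OF x, of 5 1 23, simplified]
    sin_scaled_Taylor_upper[OF x, of 5 1 23, simplified]
  note t7 = cos_scaled_Taylor_lower[OF x, of 1 2 22, simplified]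
    cos_scaled_Taylor_upper[OF x, of 1 2 22, simplified]
  note t8 = cos_scaled_Taylor_lower[OF x, of 3 2 22, simplified]
    cos_scaled_Taylor_upper[OF x, of 3 2 22, simplified]
  note t9 = sin_scaled_Taylor_lower[OF x, of 1 3 21, simplified]
    sin_scaled_Taylor_upper[OF x, of 1 3 21, simplified]
  note t10 = sin_scaled_Taylor_lower[OF x, of 3 3 21, simplified]
    sin_scaled_Taylor_upper[OF x, of 3 3 21, simplified]
  \<comment> \<open>The \<open>x ^ 10\<close> terms cancel, so the expansion starts at
    \<open>x ^ 12\<close>. The terms in \<open>5*x\<close> dominate the remainder and force the
    order 24.\<close>
  have taylor: "64/1575 * x ^ 12 - 416/17325 * x ^ 14 + 46168/7882875 * x ^ 16
      - 179876/212837625 * x ^ 18 + 3031129/36182396250 * x ^ 20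
      - 131040617/21173938285500 * x ^ 22 - 17/10000000 * x ^ 24
    \<le> 53/4 * cos x - 27/4 * cos (3*x) - 13/2 * cos (5*x)
      - 95/2 * (x * sin x) - 405/8 * (x * sin (3*x)) - 17/8 * (x * sin (5*x))
      + 78 * (x\<^sup>2 * cos x) + 27 * (x\<^sup>2 * cos (3*x))
      + 18 * (x ^ 3 * sin x) + 18 * (x ^ 3 * sin (3*x))"
  proof -
    have "0 \<le> x ^ 24" using x by simp
    with t1 t2 t3 t4 t5 t6 t7 t8 t9 t10 show ?thesis by linarith
  qed
  \<comment> \<open>The gained 1/50000 covers both the \<open>x ^ 22\<close> term and, through
    \<open>p2\<close>, the remainder.\<close>
  have p1: "0 < 3031129/36182396250 * x ^ 20 - 1/50000 * x ^ 22"
    by (rule consecutive_even_powers_pos) (use assms x2 in auto)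
  have p2: "0 < 27/10 * x ^ 22 - 1 * x ^ 24"
    by (rule consecutive_even_powers_pos) (use assms x2 in auto)
  have p3: "0 < 64/1575 * x ^ 12 - 416/17325 * x ^ 14 + 46168/7882875 * x ^ 16
      - 179876/212837625 * x ^ 18"
  proof -
    define y where "y = x\<^sup>2"
    \<comment> \<open>Expanding the cubic in \<open>y\<close> around the end point 5/2 leaves a
      single negative coefficient, that of \<open>d\<^sup>2\<close>; the linear term absorbs it
      because \<open>d \<le> 5/2\<close>.\<close>
    define d where "d = 5/2 - y"
    have d: "0 < d" "d \<le> 5/2" "y = 5/2 - d" using x2 unfolding d_def y_def by auto
    have "64/1575 - 416/17325 * y + 46168/7882875 * y\<^sup>2 - 179876/212837625 * y ^ 3
        = 31001/7739550 + 150037/14189175 * d - 34178/70945875 * d\<^sup>2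
          + 179876/212837625 * d ^ 3"
      unfolding d(3) by (simp add: field_simps power2_eq_square power3_eq_cube)
    moreover have "34178/70945875 * d\<^sup>2 \<le> 150037/14189175 * d"
    proof -
      have "d * d \<le> 5/2 * d" using d by (intro mult_right_mono) auto
      then show ?thesis using d by (simp add: power2_eq_square)
    qed
    ultimately have "0 < 64/1575 - 416/17325 * y + 46168/7882875 * y\<^sup>2
        - 179876/212837625 * y ^ 3"
      using zero_less_power[OF d(1), of 3] by linarith
    then have "0 < x ^ 12 * (64/1575 - 416/17325 * y + 46168/7882875 * y\<^sup>2
        - 179876/212837625 * y ^ 3)"
      by (rule mult_pos_pos[OF zero_less_power[OF assms(1)]])
    then show ?thesis unfolding y_def by (simp add: algebra_simps flip: power_mult power_add)
  qed
  have "0 < x ^ 22" using assms by simp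
  with taylor p1 p2 p3 show ?thesis using s2
    by linarith
qed

subsection \<open>Box-Cox transform and critical exponent\<close>

definition box_cox :: "real \<Rightarrow> real \<Rightarrow> real" where
  "box_cox p y = (if p = 0 then ln y else (y powr p - 1) / p)"

text \<open>The exponent 0 fits the same formula, since the derivative of \<open>ln y\<close> is
  \<open>y powr (0 - 1)\<close>. Later derivative arguments thus need no case split on
  \<open>p\<close>.\<close>

lemma has_real_derivative_box_cox [derivative_intros]:
  assumes "(f has_real_derivative f') (at x)" "0 < f x"
  shows "((\<lambda>x. box_cox p (f x)) has_real_derivative f x powr (p - 1) * f') (at x)"
proof (cases "p = 0")
  case True
  then show ?thesis using assms unfolding box_cox_def
    by (auto intro!: derivative_eq_intros simp: powr_minus divide_simps)
next
  case False
  have "((\<lambda>x. (f x powr p - 1) / p) has_real_derivative f x powr (p - 1) * f') (at x)"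
    using assms False by (auto intro!: derivative_eq_intros)
  then show ?thesis using False by (simp add: box_cox_def)
qed

lemma isCont_box_cox: "0 < y \<Longrightarrow> isCont (box_cox p) y"
  using DERIV_isCont[OF has_real_derivative_box_cox[OF DERIV_ident]] by simp

lemma box_cox_1 [simp]: "box_cox p 1 = 0"
  by (simp add: box_cox_def)

lemma box_cox_strict_mono:
  assumes "0 < x" "x < y"
  shows "box_cox p x < box_cox p y"
proof (rule DERIV_pos_imp_increasing[OF assms(2)])
  fix z assume "x \<le> z" "z \<le> y"
  then have "0 < z" using assms by simp
  then show "\<exists>d. (box_cox p has_real_derivative d) (at z) \<and> 0 < d"
    by (intro exI[of _ "z powr (p - 1) * 1"] conjI has_real_derivative_box_cox[of "\<lambda>x. x", simplified])
      (auto intro!: derivative_eq_intros)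
qed

lemma box_cox_less_iff:
  assumes "0 < x" "0 < y"
  shows "box_cox p x < box_cox p y \<longleftrightarrow> x < y"
  using box_cox_strict_mono[of x y p] box_cox_strict_mono[of y x p] assms
  by (cases x y rule: linorder_cases) auto

lemma box_cox_neg: "0 < y \<Longrightarrow> y < 1 \<Longrightarrow> box_cox p y < 0"
  using box_cox_strict_mono[of y 1 p] by simp

text \<open>Both transforms vanish at 1, and on \<open>(y, 1)\<close> the one with the larger
  exponent has the smaller slope.\<close>

lemma box_cox_strict_mono_exponent:
  assumes "0 < y" "y < 1" "p < r"
  shows "box_cox p y < box_cox r y"
proof -
  have "box_cox r 1 - box_cox p 1 < box_cox r y - box_cox p y"
  proof (rule DERIV_neg_imp_decreasing_open[OF assms(2)])
    fix z assume z: "y < z" "z < 1"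
    have "z powr (r - 1) < z powr (p - 1)"
      using z assms by (intro powr_less_mono') auto
    moreover have "((\<lambda>z. box_cox r z - box_cox p z) has_real_derivative
        z powr (r - 1) * 1 - z powr (p - 1) * 1) (at z)"
      by (intro derivative_intros) (use z assms in auto)
    ultimately show "\<exists>d. ((\<lambda>z. box_cox r z - box_cox p z) has_real_derivative d) (at z) \<and> d < 0"
      by force
  next
    have "isCont (\<lambda>z. box_cox r z - box_cox p z) z" if "z \<in> {y..1}" for z
      using that assms by (intro continuous_intros isCont_box_cox) auto
    then show "continuous_on {y..1} (\<lambda>z. box_cox r z - box_cox p z)"
      by (simp add: continuous_at_imp_continuous_on)
  qed
  then show ?thesis by simp
qed

lemma isCont_box_cox_exponent:
  assumes "0 < y"
  shows "isCont (\<lambda>p. box_cox p y) p"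
proof (cases "p = 0")
  case True
  \<comment> \<open>At exponent 0, \<open>box_cox\<close> is the limit of the difference quotient of
    \<open>p \<mapsto> y powr p\<close>.\<close>
  have "((\<lambda>p. y powr p) has_real_derivative ln y) (at 0)"
    using assms by (auto intro!: derivative_eq_intros)
  then have "(\<lambda>p. (y powr p - 1) / p) \<midarrow>0\<rightarrow> ln y"
    using assms by (simp add: DERIV_def)
  then have "(\<lambda>p. box_cox p y) \<midarrow>0\<rightarrow> ln y"
    by (rule Lim_transform_eventually)
      (auto simp: box_cox_def eventually_at_filter)
  then show ?thesis using True by (simp add: isCont_def box_cox_def)
next
  case False
  have "isCont (\<lambda>p. (y powr p - 1) / p) p"
    using assms False by (intro continuous_intros) auto
  moreover have "eventually (\<lambda>p. box_cox p y = (y powr p - 1) / p) (nhds p)"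
    using t1_space_nhds[OF False] by eventually_elim (simp add: box_cox_def)
  ultimately show ?thesis by (simp add: isCont_cong)
qed

text \<open>The end point \<open>pi / 2\<close> is included so that \<open>2 < pi\<close> can be
  read off there.\<close>

lemma sin_x_less_x:
  fixes x :: real
  assumes "0 < x" "x \<le> pi / 2"
  shows "sin x < x"
proof -
  have "0 - sin 0 < x - sin x"
  proof (rule DERIV_pos_imp_increasing_open[OF assms(1)])
    fix z assume z: "0 < z" "z < x"
    have "((\<lambda>x. x - sin x) has_real_derivative 1 - cos z) (at z)"
      by (auto intro!: derivative_eq_intros)
    moreover have "cos z < 1"
      using cos_monotone_0_pi[of 0 z] z assms pi_gt_zero by auto
    ultimately show "\<exists>d. ((\<lambda>x. x - sin x) has_real_derivative d) (at z) \<and> 0 < d"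
      by force
  qed (intro continuous_intros)
  then show ?thesis by simp
qed

lemma two_less_pi: "2 < pi"
  using sin_x_less_x[of "pi / 2"] by simp

text \<open>To unfold the description \<open>THE\<close>, existence comes from the intermediate
  value theorem and uniqueness from strict monotonicity in the exponent.\<close>

lemma pcrit_box_cox:
  assumes "0 < q"
  shows "3 * box_cox (pcrit q) (2 / pi) = - 1 / q"
proof -
  have y: "0 < 2 / pi" "2 / pi < 1" using two_less_pi by auto
  have eq: "(if p = 0 then q * ln (pi / 2) else q / p * (1 - (2 / pi) powr p)) = 1 / 3
      \<longleftrightarrow> 3 * box_cox p (2 / pi) = - 1 / q" for p
    using assms y by (auto simp: box_cox_def ln_div field_simps)
  have "LIM p at_bot. 3 * ((2 / pi) powr p - 1) / p :> at_bot"
    using y by real_asymp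
  then have "eventually (\<lambda>p. 3 * ((2 / pi) powr p - 1) / p \<le> - 1 / q) at_bot"
    by (simp add: filterlim_at_bot)
  then obtain N where N: "\<And>p. p \<le> N \<Longrightarrow> 3 * ((2 / pi) powr p - 1) / p \<le> - 1 / q"
    unfolding eventually_at_bot_linorder by blast
  \<comment> \<open>The minimum with -1 keeps \<open>a\<close> away from 0, where
    \<open>box_cox\<close> is a logarithm rather than the quotient.\<close>
  define a where "a = min N (-1)"
  have a: "a < 0" "3 * ((2 / pi) powr a - 1) / a \<le> - 1 / q"
    using N[of a] by (auto simp: a_def)
  have "\<exists>p. a \<le> p \<and> p \<le> 3 * q \<and> 3 * box_cox p (2 / pi) = - 1 / q"
  proof (rule IVT)
    show "3 * box_cox a (2 / pi) \<le> - 1 / q" using a by (simp add: box_cox_def)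
    \<comment> \<open>At the exponent \<open>3 * q\<close> the left side of the equation is
      \<open>((2 / pi) powr (3 * q) - 1) / q\<close>.\<close>
    show "- 1 / q \<le> 3 * box_cox (3 * q) (2 / pi)"
      using assms by (simp add: box_cox_def divide_simps)
    show "a \<le> 3 * q" using a assms by simp
    show "\<forall>x. a \<le> x \<and> x \<le> 3 * q \<longrightarrow> isCont (\<lambda>p. 3 * box_cox p (2 / pi)) x"
      using y by (intro allI impI continuous_intros isCont_box_cox_exponent) auto
  qed
  then have "\<exists>!p. 3 * box_cox p (2 / pi) = - 1 / q"
    using box_cox_strict_mono_exponent[OF y] by (metis less_irrefl linorder_neqE
      mult_left_cancel zero_neq_numeral)
  then show ?thesis
    unfolding pcrit_def eq by (rule theI')
qed

lemma le_pcrit_iff: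
  assumes "0 < q"
  shows "p \<le> pcrit q \<longleftrightarrow> 3 * box_cox p (2 / pi) + 1 / q \<le> 0"
    and "pcrit q \<le> p \<longleftrightarrow> 0 \<le> 3 * box_cox p (2 / pi) + 1 / q"
proof -
  have y: "0 < 2 / pi" "2 / pi < 1" using two_less_pi by auto
  note pcrit_box_cox[OF assms]
  moreover have "p < pcrit q \<Longrightarrow> box_cox p (2 / pi) < box_cox (pcrit q) (2 / pi)"
    "pcrit q < p \<Longrightarrow> box_cox (pcrit q) (2 / pi) < box_cox p (2 / pi)"
    using box_cox_strict_mono_exponent[OF y] by auto
  ultimately show "p \<le> pcrit q \<longleftrightarrow> 3 * box_cox p (2 / pi) + 1 / q \<le> 0"
    and "pcrit q \<le> p \<longleftrightarrow> 0 \<le> 3 * box_cox p (2 / pi) + 1 / q"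
    by (cases p "pcrit q" rule: linorder_cases; simp)+
qed

section \<open>Reduction of both inequalities to the sign of \<open>sinc_gap\<close>\<close>

text \<open>All four limiting conventions amount to inverting \<open>box_cox p\<close> at
  \<open>box_cox q t / 3\<close>. The condition on \<open>p\<close> makes the base
  \<open>1 + p / 3 * box_cox q t\<close> positive, so that the inversion is valid.\<close>

lemma Mpq_box_cox:
  assumes h: "p \<le> 0 \<or> (0 < p \<and> p \<le> 3 * q)" and t: "0 < t" "t < 1"
  shows "0 < Mpq p q t" and "3 * box_cox p (Mpq p q t) = box_cox q t"
proof -
  have pos: "0 < 1 + p / 3 * box_cox q t"
  proof (cases "p \<le> 0")
    case True
    then have "0 \<le> p / 3 * box_cox q t"
      using box_cox_neg[OF t, of q] by (intro mult_nonpos_nonpos) auto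
    then show ?thesis by simp
  next
    case False
    then have q: "0 < p" "p \<le> 3 * q" "0 < q" using h by auto
    have "1 + p / 3 * box_cox q t = (1 - p / (3 * q)) + p / (3 * q) * t powr q"
      using q by (simp add: box_cox_def field_simps)
    also have "\<dots> > 0" using q t by (intro add_nonneg_pos) (auto simp: field_simps)
    finally show ?thesis .
  qed
  have M: "Mpq p q t = (if p = 0 then exp (box_cox q t / 3)
      else (1 + p / 3 * box_cox q t) powr (1 / p))"
    using t by (auto simp: Mpq_def box_cox_def powr_def diff_divide_distrib
        algebra_simps)
  show "0 < Mpq p q t" using pos by (simp add: M)
  show "3 * box_cox p (Mpq p q t) = box_cox q t"
    using pos by (simp add: M box_cox_def[of p] powr_powr)
qed

definition sinc_gap :: "real \<Rightarrow> real \<Rightarrow> real \<Rightarrow> real" where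
  "sinc_gap p q x = 3 * box_cox p (sin x / x) - box_cox q (cos x)"

lemma sinc_bounds:
  fixes x :: real
  assumes "0 < x" "x < pi / 2"
  shows "0 < sin x" "0 < cos x" "cos x < 1" "sin x < x" "0 < sin x - x * cos x"
proof -
  show s: "0 < sin x" "0 < cos x" "sin x < x" 
    using assms by (auto intro: sin_gt_zero2 cos_gt_zero sin_x_less_x)
  show "cos x < 1" using cos_monotone_0_pi[of 0 x] assms by simp
  have "sin 0 - 0 * cos 0 < sin x - x * cos x"
  proof (rule DERIV_pos_imp_increasing_open[OF assms(1)])
    fix z assume z: "0 < z" "z < x"
    have "((\<lambda>x. sin x - x * cos x) has_real_derivative z * sin z) (at z)"
      by (auto intro!: derivative_eq_intros)
    moreover have "0 < z * sin z" using z assms by (intro mult_pos_pos sin_gt_zero2) auto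
    ultimately show "\<exists>y. ((\<lambda>x. sin x - x * cos x) has_real_derivative y) (at z) \<and> 0 < y"
      by blast
  qed (intro continuous_intros)
  then show "0 < sin x - x * cos x" by simp
qed

text \<open>The increasing map \<open>box_cox p\<close> is applied to both sides of each
  inequality.\<close>

lemma ineq_iff_sinc_gap:
  assumes h: "p \<le> 0 \<or> (0 < p \<and> p \<le> 3 * q)"
  shows "lower_ineq p q \<longleftrightarrow> (\<forall>x\<in>{0<..<pi/2}. 0 < sinc_gap p q x)"
    and "upper_ineq p q \<longleftrightarrow> (\<forall>x\<in>{0<..<pi/2}. sinc_gap p q x < 0)"
proof -
  have "(Mpq p q (cos x) < sin x / x \<longleftrightarrow> 0 < sinc_gap p q x) \<and>
        (sin x / x < Mpq p q (cos x) \<longleftrightarrow> sinc_gap p q x < 0)"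
    if "x \<in> {0<..<pi/2}" for x
  proof -
    have x: "0 < x" "x < pi / 2" using that by auto
    note b = sinc_bounds[OF x]
    note M = Mpq_box_cox[OF h b(2,3)]
    have S: "0 < sin x / x" using b x by simp
    show ?thesis
      using box_cox_less_iff[OF M(1) S, of p] box_cox_less_iff[OF S M(1), of p] M(2)
      unfolding sinc_gap_def by auto
  qed
  then show "lower_ineq p q \<longleftrightarrow> (\<forall>x\<in>{0<..<pi/2}. 0 < sinc_gap p q x)"
    and "upper_ineq p q \<longleftrightarrow> (\<forall>x\<in>{0<..<pi/2}. sinc_gap p q x < 0)"
    unfolding lower_ineq_def upper_ineq_def by auto
qed

section \<open>Limits of \<open>sinc_gap\<close> at the two end points\<close>

lemma sinc_gap_tendsto_0: "(sinc_gap p q \<longlongrightarrow> 0) (at_right 0)"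
proof -
  have "((\<lambda>x::real. sin x / x) \<longlongrightarrow> 1) (at_right 0)" "(cos \<longlongrightarrow> (1::real)) (at_right 0)"
    by real_asymp+
  moreover have "isCont (box_cox r) 1" for r
    by (rule isCont_box_cox) simp
  ultimately have "((\<lambda>x. 3 * box_cox p (sin x / x) - box_cox q (cos x)) \<longlongrightarrow>
      3 * box_cox p 1 - box_cox q 1) (at_right 0)"
    by (intro tendsto_intros isCont_tendsto_compose[where g = "box_cox _"])
  then show ?thesis by (simp add: sinc_gap_def [abs_def])
qed

lemma sinc_gap_tendsto_pi_half:
  assumes "0 < q"
  shows "(sinc_gap p q \<longlongrightarrow> 3 * box_cox p (2 / pi) + 1 / q) (at_left (pi / 2))"
proof -
  have "isCont (\<lambda>x. box_cox p (sin x / x)) (pi / 2)"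
    by (rule DERIV_isCont) (auto intro!: derivative_eq_intros)
  then have 1: "((\<lambda>x. box_cox p (sin x / x)) \<longlongrightarrow> box_cox p (2 / pi)) (at_left (pi / 2))"
    by (simp add: isCont_def filterlim_at_split)
  have cos: "(cos \<longlongrightarrow> 0) (at_left (pi / 2))"
    by real_asymp
  have "eventually (\<lambda>x. x \<in> {0<..<pi/2}) (at_left (pi / 2))"
    by (rule eventually_at_left_real) simp
  \<comment> \<open>The base tends to 0, where \<open>powr\<close> is continuous only from the
    nonnegative side; the value \<open>0 powr q\<close> is 0.\<close>
  then have "eventually (\<lambda>x. 0 \<le> cos x) (at_left (pi / 2))"
    by eventually_elim (simp add: cos_ge_zero)
  then have "((\<lambda>x. (cos x powr q - 1) / q) \<longlongrightarrow> (0 powr q - 1) / q) (at_left (pi / 2))"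
    using cos assms by (intro tendsto_intros) auto
  then have 2: "((\<lambda>x. box_cox q (cos x)) \<longlongrightarrow> - 1 / q) (at_left (pi / 2))"
    using assms by (simp add: box_cox_def)
  show ?thesis using tendsto_diff[OF tendsto_mult[OF tendsto_const[of 3] 1] 2]
    by (simp add: sinc_gap_def [abs_def])
qed

subsection \<open>Derivatives and monotonicity\<close>

definition gap_B :: "real \<Rightarrow> real" where
  "gap_B x = x * (sin x)\<^sup>2 / (cos x * (sin x - x * cos x))"

definition gap_E :: "real \<Rightarrow> real" where
  "gap_E x = (x * sin x / (sin x - x * cos x))\<^sup>2 - 3 * (sin x / (sin x - x * cos x)) + 2"

lemma gap_E_deriv:
  fixes x :: real
  assumes "0 < x" "x < pi / 2"
  defines "w \<equiv> sin x - x * cos x"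
  shows "(gap_E has_real_derivative
    (3 * (x - cos x * sin x) * w - 2 * x * sin x * (x\<^sup>2 - (sin x)\<^sup>2)) / w ^ 3) (at x)"
proof -
  have w: "0 < w" using sinc_bounds[OF assms(1,2)] by (simp add: w_def)
  have 0: "((\<lambda>x. sin x - x * cos x) has_real_derivative x * sin x) (at x)"
    by (auto intro!: derivative_eq_intros)
  have 1: "((\<lambda>x. sin x / (sin x - x * cos x)) has_real_derivative
      (cos x * sin x - x) / w\<^sup>2) (at x)"
  proof -
    \<comment> \<open>Keeping \<open>(sin x)\<^sup>2 + (cos x)\<^sup>2\<close> unevaluated makes
      this a pure polynomial identity; the sum is replaced by 1 only afterwards.\<close>
    have "cos x * w - sin x * (x * sin x) = cos x * sin x - x * ((sin x)\<^sup>2 + (cos x)\<^sup>2)"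
      by (simp add: w_def algebra_simps power2_eq_square
          del: sin_cos_squared_add sin_cos_squared_add2 sin_cos_squared_add3)
    then have "cos x * w - sin x * (x * sin x) = cos x * sin x - x"
      by (simp only: sin_cos_squared_add mult_1_right)
    then show ?thesis
      using DERIV_divide[OF DERIV_sin 0] w by (simp add: w_def power2_eq_square)
  qed
  have 2: "((\<lambda>x. x * sin x / (sin x - x * cos x)) has_real_derivative
      ((sin x)\<^sup>2 - x\<^sup>2) / w\<^sup>2) (at x)"
  proof -
    have "((\<lambda>x. x * sin x) has_real_derivative sin x + x * cos x) (at x)"
      by (auto intro!: derivative_eq_intros)
    moreover have "(sin x + x * cos x) * w - x * sin x * (x * sin x) = (sin x)\<^sup>2 - x\<^sup>2"
    proof -
      have "(sin x + x * cos x) * w - x * sin x * (x * sin x)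
          = (sin x)\<^sup>2 - x\<^sup>2 * ((sin x)\<^sup>2 + (cos x)\<^sup>2)"
        by (simp add: w_def algebra_simps power2_eq_square
            del: sin_cos_squared_add sin_cos_squared_add2 sin_cos_squared_add3)
      then show ?thesis
        by (simp only: sin_cos_squared_add mult_1_right)
    qed
    ultimately show ?thesis
      using DERIV_divide[OF _ 0, of "\<lambda>x. x * sin x" "sin x + x * cos x"] w
      by (simp add: w_def power2_eq_square)
  qed
  have "2 * (x * sin x / w) * (((sin x)\<^sup>2 - x\<^sup>2) / w\<^sup>2) - 3 * ((cos x * sin x - x) / w\<^sup>2)
    = (3 * (x - cos x * sin x) * w - 2 * x * sin x * (x\<^sup>2 - (sin x)\<^sup>2)) / w ^ 3"
    using w by (simp add: field_simps power2_eq_square power3_eq_cube)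
  moreover have "(gap_E has_real_derivative
      2 * (x * sin x / w) * (((sin x)\<^sup>2 - x\<^sup>2) / w\<^sup>2) - 3 * ((cos x * sin x - x) / w\<^sup>2)) (at x)"
    using DERIV_add[OF DERIV_diff[OF DERIV_power[OF 2, of 2] DERIV_cmult[OF 1, of 3]]
        DERIV_const[of 2]]
    unfolding gap_E_def [abs_def] by (simp add: w_def mult_ac)
  ultimately show ?thesis by simp
qed

lemma gap_B_deriv:
  fixes x :: real
  assumes "0 < x" "x < pi / 2"
  defines "w \<equiv> sin x - x * cos x"
  shows "(gap_B has_real_derivative
    sin x * ((sin x)\<^sup>2 * cos x + x * sin x - 2 * x\<^sup>2 * cos x) / ((cos x)\<^sup>2 * w\<^sup>2)) (at x)"
proof -
  have w: "0 < w" "0 < cos x" using sinc_bounds[OF assms(1,2)] by (auto simp: w_def)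
  have 1: "((\<lambda>x. x * (sin x)\<^sup>2) has_real_derivative (sin x)\<^sup>2 + 2 * x * sin x * cos x) (at x)"
    by (auto intro!: derivative_eq_intros simp: power2_eq_square)
  have 2: "((\<lambda>x. cos x * (sin x - x * cos x)) has_real_derivative
      cos x * (x * sin x) - sin x * w) (at x)"
    by (auto intro!: derivative_eq_intros simp: w_def algebra_simps)
  have 3: "((sin x)\<^sup>2 + 2 * x * sin x * cos x) * (cos x * w)
      - x * (sin x)\<^sup>2 * (cos x * (x * sin x) - sin x * w)
    = sin x * ((sin x)\<^sup>2 * cos x + x * sin x * ((sin x)\<^sup>2 + (cos x)\<^sup>2)
       - 2 * x\<^sup>2 * cos x * ((sin x)\<^sup>2 + (cos x)\<^sup>2))"
    by (simp add: w_def algebra_simps power2_eq_square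
        del: sin_cos_squared_add sin_cos_squared_add2 sin_cos_squared_add3)
  have "(gap_B has_real_derivative
      (((sin x)\<^sup>2 + 2 * x * sin x * cos x) * (cos x * w)
      - x * (sin x)\<^sup>2 * (cos x * (x * sin x) - sin x * w)) / (cos x * w * (cos x * w))) (at x)"
    unfolding gap_B_def [abs_def] w_def
    by (rule DERIV_divide) (use 1 2 w in \<open>auto simp: w_def\<close>)
  then show ?thesis unfolding 3 sin_cos_squared_add by (simp add: power2_eq_square mult_ac)
qed

lemma strict_mono_on_openI:
  fixes f :: "real \<Rightarrow> real"
  assumes "\<And>x. a < x \<Longrightarrow> x < b \<Longrightarrow> \<exists>d. (f has_real_derivative d) (at x) \<and> 0 < d"
    and "a < x" "x < y" "y < b"
  shows "f x < f y"
  by (rule DERIV_pos_imp_increasing[OF assms(3)]) (use assms in auto)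

lemma gap_E_strict_mono:
  assumes "0 < x" "x < y" "y < pi / 2"
  shows "gap_E x < gap_E y"
proof (rule strict_mono_on_openI[OF _ assms])
  fix z :: real assume z: "0 < z" "z < pi / 2"
  show "\<exists>d. (gap_E has_real_derivative d) (at z) \<and> 0 < d"
    using gap_E_deriv[OF z] numerator1_pos[OF z] sinc_bounds[OF z] by force
qed

lemma gap_B_minus_gap_E_strict_mono:
  assumes "0 < x" "x < y" "y < pi / 2"
  shows "gap_B x / 35 - gap_E x < gap_B y / 35 - gap_E y"
proof (rule strict_mono_on_openI[OF _ assms])
  fix z :: real assume z: "0 < z" "z < pi / 2"
  define w where "w = sin z - z * cos z"
  define n where "n = 3 * (z - cos z * sin z) * w - 2 * z * sin z * (z\<^sup>2 - (sin z)\<^sup>2)"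
  define m where "m = sin z * ((sin z)\<^sup>2 * cos z + z * sin z - 2 * z\<^sup>2 * cos z)"
  have w: "0 < w" "0 < cos z" using sinc_bounds[OF z] by (auto simp: w_def)
  have "35 * (cos z)\<^sup>2 * n < w * m"
    using numerator2_pos[OF z] by (simp add: w_def n_def m_def mult_ac)
  then have "n / w ^ 3 < m / ((cos z)\<^sup>2 * w\<^sup>2) / 35"
    using w by (simp add: field_simps power2_eq_square power3_eq_cube)
  moreover have "((\<lambda>x. gap_B x / 35 - gap_E x) has_real_derivative
      m / ((cos z)\<^sup>2 * w\<^sup>2) / 35 - n / w ^ 3) (at z)"
    using gap_B_deriv[OF z] gap_E_deriv[OF z] unfolding m_def n_def w_def
    by (auto intro!: derivative_eq_intros)
  ultimately show "\<exists>d. ((\<lambda>x. gap_B x / 35 - gap_E x) has_real_derivative d) (at z) \<and> 0 < d"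
    by force
qed

text \<open>Up to the factor 35, \<open>gap_B\<close> is the sum of the increasing functions
  \<open>gap_B / 35 - gap_E\<close> and \<open>gap_E\<close>.\<close>

lemma gap_B_strict_mono:
  assumes "0 < x" "x < y" "y < pi / 2"
  shows "gap_B x < gap_B y"
  using gap_E_strict_mono[OF assms] gap_B_minus_gap_E_strict_mono[OF assms] by simp

lemma gap_B_tendsto: "(gap_B \<longlongrightarrow> 3) (at_right 0)"
  unfolding gap_B_def [abs_def] by real_asymp

lemma gap_E_tendsto: "(gap_E \<longlongrightarrow> 7 / 5) (at_right 0)"
  unfolding gap_E_def [abs_def] by real_asymp

section \<open>The auxiliary functions \<open>gap_G\<close> and \<open>gap_L\<close>\<close>

definition gap_G :: "real \<Rightarrow> real \<Rightarrow> real \<Rightarrow> real" where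
  "gap_G p q x = p - gap_E x - (q - 1) * gap_B x"

definition gap_L :: "real \<Rightarrow> real \<Rightarrow> real \<Rightarrow> real" where
  "gap_L p q x = (q - 1) * ln (cos x) + ln (x\<^sup>2 * sin x / (3 * (sin x - x * cos x)))
      - (p - 1) * ln (sin x / x)"

lemma gap_G_strict_antimono:
  assumes "1 \<le> q" "0 < x" "x < y" "y < pi / 2"
  shows "gap_G p q y < gap_G p q x"
  using gap_E_strict_mono[OF assms(2-4)] gap_B_strict_mono[OF assms(2-4)] assms
    mult_left_mono[of "gap_B x" "gap_B y" "q - 1"]
  by (simp add: gap_G_def)

text \<open>Here \<open>gap_G\<close> is
  \<open>p + (gap_B / 35 - gap_E) + (34/35 - q) * gap_B\<close>, which explains the bound
  34/35.\<close>

lemma gap_G_strict_mono: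
  assumes "q \<le> 34 / 35" "0 < x" "x < y" "y < pi / 2"
  shows "gap_G p q x < gap_G p q y"
  using gap_B_minus_gap_E_strict_mono[OF assms(2-4)] gap_B_strict_mono[OF assms(2-4)] assms
    mult_left_mono[of "gap_B x" "gap_B y" "34 / 35 - q"]
  by (simp add: gap_G_def algebra_simps)

lemma gap_G_tendsto: "(gap_G p q \<longlongrightarrow> p - (3 * q - 8 / 5)) (at_right 0)"
proof -
  have "((\<lambda>x. p - gap_E x - (q - 1) * gap_B x) \<longlongrightarrow> p - 7 / 5 - (q - 1) * 3) (at_right 0)"
    by (intro tendsto_intros gap_E_tendsto gap_B_tendsto)
  then show ?thesis by (simp add: gap_G_def [abs_def] algebra_simps)
qed

lemma gap_L_tendsto: "(gap_L p q \<longlongrightarrow> 0) (at_right 0)"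
proof -
  have "((\<lambda>x::real. ln (cos x)) \<longlongrightarrow> 0) (at_right 0)"
    "((\<lambda>x::real. ln (x\<^sup>2 * sin x / (3 * (sin x - x * cos x)))) \<longlongrightarrow> 0) (at_right 0)"
    "((\<lambda>x::real. ln (sin x / x)) \<longlongrightarrow> 0) (at_right 0)"
    by real_asymp+
  then have "(gap_L p q \<longlongrightarrow> (q - 1) * 0 + 0 - (p - 1) * 0) (at_right 0)"
    unfolding gap_L_def [abs_def] by (intro tendsto_intros)
  then show ?thesis by simp
qed

lemma gap_L_deriv:
  assumes "0 < x" "x < pi / 2"
  shows "(gap_L p q has_real_derivative
    gap_G p q x * ((sin x - x * cos x) / (x * sin x))) (at x)"
proof -
  define w where "w = sin x - x * cos x"
  have b: "0 < sin x" "0 < cos x" "0 < w" using sinc_bounds[OF assms] by (auto simp: w_def)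
  have w': "((\<lambda>x. sin x - x * cos x) has_real_derivative x * sin x) (at x)"
    by (auto intro!: derivative_eq_intros)
  \<comment> \<open>The logarithms are split before differentiating; the split form agrees with
    \<open>gap_L\<close> on the open interval only.\<close>
  have d: "((\<lambda>x. (q - 1) * ln (cos x) + (2 * ln x + ln (sin x) - ln 3 - ln (sin x - x * cos x))
      - (p - 1) * (ln (sin x) - ln x)) has_real_derivative
      (q - 1) * (- sin x / cos x) + (2 / x + cos x / sin x - x * sin x / w)
      - (p - 1) * (cos x / sin x - 1 / x)) (at x)"
    using b assms by (auto intro!: derivative_eq_intros simp: w_def mult_ac)
  have "(q - 1) * (- sin x / cos x) + (2 / x + cos x / sin x - x * sin x / w)
      - (p - 1) * (cos x / sin x - 1 / x) = gap_G p q x * (w / (x * sin x))"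
  proof -
    \<comment> \<open>These three products explain the shape of \<open>gap_B\<close> and
      \<open>gap_E\<close>: they collect the coefficients of \<open>p\<close>, of
      \<open>q - 1\<close> and the rest of the derivative.\<close>
    have 1: "w / (x * sin x) = 1 / x - cos x / sin x"
      using b assms by (simp add: w_def field_simps)
    have 2: "gap_B x * (w / (x * sin x)) = sin x / cos x"
      using b assms by (simp add: gap_B_def flip: w_def) (simp add: field_simps power2_eq_square)
    have 3: "gap_E x * (w / (x * sin x)) = x * sin x / w - 3 / x + 2 * (1 / x - cos x / sin x)"
    proof -
      have X: "(x * sin x / w)\<^sup>2 * (w / (x * sin x)) = x * sin x / w"
        and Y: "3 * (sin x / w) * (w / (x * sin x)) = 3 / x"
        using b assms by (simp_all add: power2_eq_square)
      have "gap_E x * (w / (x * sin x)) = (x * sin x / w)\<^sup>2 * (w / (x * sin x))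
          - 3 * (sin x / w) * (w / (x * sin x)) + 2 * (w / (x * sin x))"
        unfolding gap_E_def w_def [symmetric] by (simp only: left_diff_distrib distrib_right)
      also have "\<dots> = x * sin x / w - 3 / x + 2 * (1 / x - cos x / sin x)"
        by (subst X, subst Y, subst 1) (rule refl)
      finally show ?thesis .
    qed
    have "gap_G p q x * (w / (x * sin x))
      = p * (w / (x * sin x)) - gap_E x * (w / (x * sin x)) - (q - 1) * (gap_B x * (w / (x * sin x)))"
      by (simp only: gap_G_def left_diff_distrib mult.assoc)
    also have "\<dots> = p * (1 / x - cos x / sin x) - (x * sin x / w - 3 / x + 2 * (1 / x - cos x / sin x))
        - (q - 1) * (sin x / cos x)"
      unfolding 1 [symmetric] 2 3 by (simp only: 1)
    finally show ?thesis
      by (simp add: algebra_simps add_divide_distrib diff_divide_distrib)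
  qed
  with d have d': "((\<lambda>x. (q - 1) * ln (cos x) + (2 * ln x + ln (sin x) - ln 3 - ln (sin x - x * cos x))
      - (p - 1) * (ln (sin x) - ln x)) has_real_derivative gap_G p q x * (w / (x * sin x))) (at x)"
    by simp
  have "(q - 1) * ln (cos y) + (2 * ln y + ln (sin y) - ln 3 - ln (sin y - y * cos y))
      - (p - 1) * (ln (sin y) - ln y) = gap_L p q y" if "y \<in> {0<..<pi/2}" for y
    using sinc_bounds[of y] that 
    by (simp add: gap_L_def ln_div ln_mult ln_realpow del: right_diff_distrib_numeral)
  with assms show ?thesis unfolding w_def [symmetric]
    by (intro has_field_derivative_transform_within_open[OF d', of "{0<..<pi/2}"]) auto
qed

text \<open>The derivative is a difference \<open>u - v\<close> of positive terms, and
  \<open>gap_L\<close> is \<open>ln u - ln v\<close>.\<close>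

lemma sinc_gap_deriv:
  assumes "0 < x" "x < pi / 2"
  obtains d where "(sinc_gap p q has_real_derivative d) (at x)" "sgn d = sgn (gap_L p q x)"
proof -
  define w where "w = sin x - x * cos x"
  have b: "0 < sin x" "0 < cos x" "0 < w" "0 < sin x / x"
    using sinc_bounds[OF assms] assms by (auto simp: w_def)
  define u where "u = cos x powr (q - 1) * sin x"
  define v where "v = 3 * ((sin x / x) powr (p - 1) * (w / x\<^sup>2))"
  have "((\<lambda>x. sin x / x) has_real_derivative - (w / x\<^sup>2)) (at x)"
    using assms by (auto intro!: derivative_eq_intros simp: w_def field_simps power2_eq_square)
  then have "(sinc_gap p q has_real_derivative
      3 * ((sin x / x) powr (p - 1) * - (w / x\<^sup>2)) - cos x powr (q - 1) * - sin x) (at x)"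
    unfolding sinc_gap_def [abs_def] using b(2,4)
    by (intro DERIV_diff DERIV_cmult has_real_derivative_box_cox DERIV_cos)
  then have "(sinc_gap p q has_real_derivative u - v) (at x)"
    by (simp add: u_def v_def)
  moreover have "sgn (u - v) = sgn (gap_L p q x)"
  proof -
    have uv: "0 < u" "0 < v" using b assms by (simp_all add: u_def v_def)
    have "ln u = (q - 1) * ln (cos x) + ln (sin x)"
      using b by (simp add: u_def ln_mult)
    moreover have "ln v = ln 3 + (p - 1) * ln (sin x / x) + ln w - 2 * ln x"
      using b assms by (simp add: v_def ln_mult ln_div ln_realpow)
    moreover have "ln (x\<^sup>2 * sin x / (3 * w)) = 2 * ln x + ln (sin x) - ln 3 - ln w"
      using b assms by (simp add: ln_mult ln_div ln_realpow)
    ultimately have "gap_L p q x = ln u - ln v"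
      by (simp add: gap_L_def flip: w_def)
    then show ?thesis
      using uv ln_less_cancel_iff[of u v] ln_less_cancel_iff[of v u]
      by (cases u v rule: linorder_cases) auto
  qed
  ultimately show ?thesis by (rule that)
qed

text \<open>The factor \<open>s\<close> will be 1 or -1, so that one sign argument serves both
  inequalities.\<close>

lemma scaled_sinc_gap_deriv:
  assumes "0 < x" "x < pi / 2"
  obtains d where "((\<lambda>x. s * sinc_gap p q x) has_real_derivative d) (at x)"
    "sgn d = sgn (s * gap_L p q x)"
  using sinc_gap_deriv[OF assms, of p q] by (metis DERIV_cmult sgn_mult)

lemma scaled_gap_L_deriv:
  assumes "0 < x" "x < pi / 2"
  obtains d where "((\<lambda>x. s * gap_L p q x) has_real_derivative d) (at x)"
    "sgn d = sgn (s * gap_G p q x)"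
proof
  show "((\<lambda>x. s * gap_L p q x) has_real_derivative
      s * (gap_G p q x * ((sin x - x * cos x) / (x * sin x)))) (at x)"
    using gap_L_deriv[OF assms] by (rule DERIV_cmult)
  show "sgn (s * (gap_G p q x * ((sin x - x * cos x) / (x * sin x)))) = sgn (s * gap_G p q x)"
    using sinc_bounds[OF assms] assms by (simp add: sgn_mult)
qed

subsection \<open>Sign of the gap\<close>

text \<open>Only the right limit at 0 enters, not the value there. The limit is at most
  \<open>f (x / 2)\<close>, and the increase from \<open>x / 2\<close> to \<open>x\<close> gives
  strictness.\<close>

lemma pos_if_deriv_pos_tendsto_0:
  fixes f :: "real \<Rightarrow> real"
  assumes lim: "(f \<longlongrightarrow> 0) (at_right 0)" and x: "0 < x" and cont: "isCont f x"
    and deriv: "\<And>y. 0 < y \<Longrightarrow> y < x \<Longrightarrow> \<exists>d. (f has_real_derivative d) (at y) \<and> 0 < d"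
  shows "0 < f x"
proof -
  have c: "isCont f y" if "0 < y" "y \<le> x" for y
    using deriv[of y] cont that DERIV_isCont by (cases "y = x") auto
  have mono: "f y < f z" if "0 < y" "y < z" "z \<le> x" for y z
    by (rule DERIV_pos_imp_increasing_open[OF that(2)])
      (use deriv c that in \<open>auto intro!: continuous_at_imp_continuous_on\<close>)
  have "eventually (\<lambda>y. y \<in> {0<..<x/2}) (at_right 0)"
    by (rule eventually_at_right_real) (use x in simp)
  then have "eventually (\<lambda>y. f y \<le> f (x / 2)) (at_right 0)"
    by eventually_elim (use mono x in \<open>force intro: less_imp_le\<close>)
  then have "0 \<le> f (x / 2)"
    by (intro tendsto_upperbound[OF lim]) auto
  also have "\<dots> < f x" using mono[of "x / 2" x] x by simp
  finally show ?thesis .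
qed

lemma scaled_gap_L_pos:
  assumes "0 < x" "x < pi / 2" "\<And>y. 0 < y \<Longrightarrow> y < x \<Longrightarrow> 0 < s * gap_G p q y"
  shows "0 < s * gap_L p q x"
proof (rule pos_if_deriv_pos_tendsto_0[OF _ assms(1)])
  show "((\<lambda>x. s * gap_L p q x) \<longlongrightarrow> 0) (at_right 0)"
    using gap_L_tendsto tendsto_mult_right_zero by blast
  show "isCont (\<lambda>x. s * gap_L p q x) x"
    using scaled_gap_L_deriv[OF assms(1,2), of s p q] DERIV_isCont by metis
  show "\<exists>d. ((\<lambda>x. s * gap_L p q x) has_real_derivative d) (at y) \<and> 0 < d"
    if "0 < y" "y < x" for y
    using scaled_gap_L_deriv[of y s p q] assms that
    by (metis less_trans sgn_1_pos)
qed

lemma scaled_sinc_gap_pos: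
  assumes "0 < x" "x < pi / 2" "\<And>y. 0 < y \<Longrightarrow> y < x \<Longrightarrow> 0 < s * gap_L p q y"
  shows "0 < s * sinc_gap p q x"
proof (rule pos_if_deriv_pos_tendsto_0[OF _ assms(1)])
  show "((\<lambda>x. s * sinc_gap p q x) \<longlongrightarrow> 0) (at_right 0)"
    using sinc_gap_tendsto_0 tendsto_mult_right_zero by blast
  show "isCont (\<lambda>x. s * sinc_gap p q x) x"
    using scaled_sinc_gap_deriv[OF assms(1,2), of s p q] DERIV_isCont by metis
  show "\<exists>d. ((\<lambda>x. s * sinc_gap p q x) has_real_derivative d) (at y) \<and> 0 < d"
    if "0 < y" "y < x" for y
    using scaled_sinc_gap_deriv[of y s p q] assms that
    by (metis less_trans sgn_1_pos)
qed

lemma sinc_gap_sign_if_gap_G_sign: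
  assumes "0 < x" "x < pi / 2" "\<And>y. 0 < y \<Longrightarrow> y < x \<Longrightarrow> 0 < s * gap_G p q y"
  shows "0 < s * sinc_gap p q x"
  by (rule scaled_sinc_gap_pos[OF assms(1,2)], rule scaled_gap_L_pos) (use assms in auto)

text \<open>Once \<open>gap_G\<close> has changed sign, it drags first \<open>gap_L\<close> and then the slope of \<open>sinc_gap\<close>
  below zero for good, so a zero of \<open>sinc_gap\<close> would force a negative limit at \<open>pi / 2\<close>.\<close>
lemma sinc_gap_sign_if_endpoint_sign:
  assumes anti: "\<And>x y. 0 < x \<Longrightarrow> x < y \<Longrightarrow> y < pi / 2 \<Longrightarrow> s * gap_G p q y < s * gap_G p q x"
    and lim: "(sinc_gap p q \<longlongrightarrow> l) (at_left (pi / 2))" and l: "0 \<le> s * l"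
    and x: "0 < x" "x < pi / 2"
  shows "0 < s * sinc_gap p q x"
proof (rule ccontr)
  assume neg: "\<not> 0 < s * sinc_gap p q x"
  \<comment> \<open>Contrapositives of the two sign transfers give a point where
    \<open>gap_L\<close>, and before it one where \<open>gap_G\<close>, has lost its sign.\<close>
  then obtain y where y: "0 < y" "y < x" "s * gap_L p q y \<le> 0"
    using scaled_sinc_gap_pos[OF x, of s p q] by force
  then obtain z where z: "0 < z" "z < y" "s * gap_G p q z \<le> 0"
    using scaled_gap_L_pos[of y s p q] x by force
  have G: "s * gap_G p q t < 0" if "z < t" "t < pi / 2" for t
    using anti[OF z(1) that] z(3) by simp
  have L: "s * gap_L p q t < 0" if t: "y < t" "t < pi / 2" for t
  proof -
    have "s * gap_L p q t < s * gap_L p q y"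
    proof (rule DERIV_neg_imp_decreasing[OF t(1)])
      fix r assume r: "y \<le> r" "r \<le> t"
      then have "0 < r" "r < pi / 2" "s * gap_G p q r < 0" using G[of r] y z t by auto
      then show "\<exists>d. ((\<lambda>x. s * gap_L p q x) has_real_derivative d) (at r) \<and> d < 0"
        using scaled_gap_L_deriv[of r s p q] by (metis sgn_1_neg)
    qed
    then show ?thesis using y(3) by simp
  qed
  have D: "s * sinc_gap p q v < s * sinc_gap p q u" if uv: "x \<le> u" "u < v" "v < pi / 2" for u v
  proof (rule DERIV_neg_imp_decreasing[OF uv(2)])
    fix r assume r: "u \<le> r" "r \<le> v"
    then have "0 < r" "r < pi / 2" "s * gap_L p q r < 0" using L[of r] y uv x by auto
    then show "\<exists>d. ((\<lambda>x. s * sinc_gap p q x) has_real_derivative d) (at r) \<and> d < 0"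
      using scaled_sinc_gap_deriv[of r s p q] by (metis sgn_1_neg)
  qed
  \<comment> \<open>The intermediate point gives
    \<open>s * l \<le> s * sinc_gap p q m < s * sinc_gap p q x \<le> 0\<close>, with the strictness
    that contradicts \<open>0 \<le> s * l\<close>.\<close>
  define m where "m = (x + pi / 2) / 2"
  have m: "x < m" "m < pi / 2" using x by (auto simp: m_def field_simps)
  have "eventually (\<lambda>t. t \<in> {m<..<pi/2}) (at_left (pi / 2))"
    by (rule eventually_at_left_real) (use m in simp)
  then have "eventually (\<lambda>t. s * sinc_gap p q t \<le> s * sinc_gap p q m) (at_left (pi / 2))"
    by eventually_elim (use D[of m] m in \<open>force intro: less_imp_le\<close>)
  then have "s * l \<le> s * sinc_gap p q m"
    by (intro tendsto_upperbound[OF tendsto_mult[OF tendsto_const lim]]) auto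
  with D[of x m] m neg l show False by simp
qed

text \<open>A decreasing function stays below its right limit at 0, which is nonpositive here;
  passing through \<open>x / 2\<close> makes the bound strict.\<close>

lemma gap_G_neg:
  assumes "1 \<le> q" "p \<le> 3 * q - 8 / 5" "0 < x" "x < pi / 2"
  shows "gap_G p q x < 0"
proof -
  have "eventually (\<lambda>y. y \<in> {0<..<x/2}) (at_right 0)"
    by (rule eventually_at_right_real) (use assms in simp)
  then have "eventually (\<lambda>y. gap_G p q (x / 2) \<le> gap_G p q y) (at_right 0)"
    by eventually_elim (use gap_G_strict_antimono[OF assms(1)] assms in \<open>force intro: less_imp_le\<close>)
  then have "gap_G p q (x / 2) \<le> p - (3 * q - 8 / 5)"
    by (intro tendsto_lowerbound[OF gap_G_tendsto]) auto
  with gap_G_strict_antimono[OF assms(1), of "x / 2" x p] assms show ?thesis by simp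
qed

lemma gap_G_pos:
  assumes "q \<le> 34 / 35" "3 * q - 8 / 5 \<le> p" "0 < x" "x < pi / 2"
  shows "0 < gap_G p q x"
proof -
  have "eventually (\<lambda>y. y \<in> {0<..<x/2}) (at_right 0)"
    by (rule eventually_at_right_real) (use assms in simp)
  then have "eventually (\<lambda>y. gap_G p q y \<le> gap_G p q (x / 2)) (at_right 0)"
    by eventually_elim (use gap_G_strict_mono[OF assms(1)] assms in \<open>force intro: less_imp_le\<close>)
  then have "p - (3 * q - 8 / 5) \<le> gap_G p q (x / 2)"
    by (intro tendsto_upperbound[OF gap_G_tendsto]) auto
  with gap_G_strict_mono[OF assms(1), of "x / 2" x p] assms show ?thesis by simp
qed

section \<open>Necessity of the conditions on the exponents\<close>

text \<open>A nonzero limit of \<open>gap_G\<close> at 0 fixes its sign on some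
  \<open>(0, c)\<close>, and this sign passes to \<open>sinc_gap\<close>.\<close>

lemma sinc_gap_sign_near_0:
  assumes "0 < s * (p - (3 * q - 8 / 5))"
  shows "\<exists>x\<in>{0<..<pi/2}. 0 < s * sinc_gap p q x"
proof -
  have "((\<lambda>x. s * gap_G p q x) \<longlongrightarrow> s * (p - (3 * q - 8 / 5))) (at_right 0)"
    by (intro tendsto_intros gap_G_tendsto)
  then have "eventually (\<lambda>x. 0 < s * gap_G p q x) (at_right 0)"
    using assms by (rule order_tendstoD)
  then obtain c where c: "0 < c" "\<And>y. 0 < y \<Longrightarrow> y < c \<Longrightarrow> 0 < s * gap_G p q y"
    unfolding eventually_at_right_field by auto
  define x where "x = min c (pi / 4)"
  have "0 < x" "x < pi / 2" "x \<le> c" using c(1) pi_gt_zero by (auto simp: x_def min_def)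
  then show ?thesis
    using sinc_gap_sign_if_gap_G_sign[of x s p q] c(2) by force
qed

text \<open>The first bound comes from the behaviour near 0, with \<open>s = -1\<close>; the second
  from the limit at \<open>pi / 2\<close>, which inherits the weak sign.\<close>

lemma sinc_gap_pos_imp:
  assumes "\<forall>x\<in>{0<..<pi/2}. 0 < sinc_gap p q x"
  shows "3 * q - 8 / 5 \<le> p" and "0 < q \<Longrightarrow> pcrit q \<le> p"
proof -
  show "3 * q - 8 / 5 \<le> p"
    using sinc_gap_sign_near_0[of "-1" p q] assms by force
  assume q: "0 < q"
  have "eventually (\<lambda>x. x \<in> {0<..<pi/2}) (at_left (pi / 2))"
    by (rule eventually_at_left_real) simp
  then have "eventually (\<lambda>x. 0 \<le> sinc_gap p q x) (at_left (pi / 2))"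
    by eventually_elim (use assms in \<open>force intro: less_imp_le\<close>)
  then have "0 \<le> 3 * box_cox p (2 / pi) + 1 / q"
    by (intro tendsto_lowerbound[OF sinc_gap_tendsto_pi_half[OF q]]) auto
  then show "pcrit q \<le> p" using le_pcrit_iff(2)[OF q] by simp
qed

lemma sinc_gap_neg_imp:
  assumes "\<forall>x\<in>{0<..<pi/2}. sinc_gap p q x < 0"
  shows "p \<le> 3 * q - 8 / 5" and "0 < q \<Longrightarrow> p \<le> pcrit q"
proof -
  show "p \<le> 3 * q - 8 / 5"
    using sinc_gap_sign_near_0[of 1 p q] assms by force
  assume q: "0 < q"
  have "eventually (\<lambda>x. x \<in> {0<..<pi/2}) (at_left (pi / 2))"
    by (rule eventually_at_left_real) simp
  then have "eventually (\<lambda>x. sinc_gap p q x \<le> 0) (at_left (pi / 2))"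
    by eventually_elim (use assms in \<open>force intro: less_imp_le\<close>)
  then have "3 * box_cox p (2 / pi) + 1 / q \<le> 0"
    by (intro tendsto_upperbound[OF sinc_gap_tendsto_pi_half[OF q]]) auto
  then show "p \<le> pcrit q" using le_pcrit_iff(1)[OF q] by simp
qed

theorem theorem4:
  fixes q p1 p2 :: real
  assumes h1: "p1 \<le> 0 \<or> (0 < p1 \<and> p1 \<le> 3 * q)"
      and h2: "p2 \<le> 0 \<or> (0 < p2 \<and> p2 \<le> 3 * q)"
  shows "(q \<ge> 1 \<longrightarrow>
            ((lower_ineq p1 q \<and> upper_ineq p2 q) \<longleftrightarrow>
             (p1 \<ge> pcrit q \<and> p2 \<le> 3 * q - 8 / 5)))
       \<and> (0 < q \<and> q \<le> 34 / 35 \<longrightarrow>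
            ((lower_ineq p1 q \<and> upper_ineq p2 q) \<longleftrightarrow>
             (p1 \<ge> 3 * q - 8 / 5 \<and> p2 \<le> pcrit q)))
       \<and> (q \<le> 0 \<longrightarrow> (lower_ineq p1 q \<longleftrightarrow> p1 \<ge> 3 * q - 8 / 5))"
proof -
  \<comment> \<open>For \<open>q \<ge> 1\<close> the lower inequality is decided at
    \<open>pi / 2\<close> and the upper one at 0; for \<open>q \<le> 34/35\<close> the end points
    exchange roles.\<close>
  have lower_large: "0 < sinc_gap p q x"
    if "1 \<le> q" "pcrit q \<le> p" "0 < x" "x < pi / 2" for p x
    using sinc_gap_sign_if_endpoint_sign[of 1, OF _ sinc_gap_tendsto_pi_half[of q p]]
      le_pcrit_iff(2)[of q p] gap_G_strict_antimono[of q] that by simp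
  have upper_large: "sinc_gap p q x < 0"
    if "1 \<le> q" "p \<le> 3 * q - 8 / 5" "0 < x" "x < pi / 2" for p x
    using sinc_gap_sign_if_gap_G_sign[of x "-1" p q] gap_G_neg[of q p] that by simp
  \<comment> \<open>This range of \<open>q\<close> reaches below 0, so the fact serves the second
    and the third claim.\<close>
  have lower_small: "0 < sinc_gap p q x"
    if "q \<le> 34 / 35" "3 * q - 8 / 5 \<le> p" "0 < x" "x < pi / 2" for p x
    using sinc_gap_sign_if_gap_G_sign[of x 1 p q] gap_G_pos[of q p] that by simp
  have upper_small: "sinc_gap p q x < 0"
    if "0 < q" "q \<le> 34 / 35" "p \<le> pcrit q" "0 < x" "x < pi / 2" for p x
    using sinc_gap_sign_if_endpoint_sign[of "-1", OF _ sinc_gap_tendsto_pi_half[of q p]]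
      le_pcrit_iff(1)[of q p] gap_G_strict_mono[of q] that by simp
  show ?thesis
    unfolding ineq_iff_sinc_gap[OF h1] ineq_iff_sinc_gap[OF h2]
    using lower_large upper_large lower_small upper_small
      sinc_gap_pos_imp[of p1 q] sinc_gap_neg_imp[of p2 q]
    by (intro conjI impI iffI) auto
qed

end
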